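(* Let $X$ be a topological space. A kernel of hyperbolic type $K\in\mathcal K(X)$ is arboreal if and only if it has critical exponent $t_K=\infty$.
   Context: A kernel on $X$ is a continuous symmetric function $K\colon X\times X\to\mathbb R$; it is of hyperbolic type when it is nonnegative, $K(x,x)=1$ for all $x$, and $\sum_{i,j=1}^n\lambda_i\lambda_jK(x_i,x_j)\le\big(\sum_{k=1}^n\lambda_kK(x_0,x_k)\big)^2$ for all $n$, $x_0,\dots,x_n\in X$, $\lambda\in\mathbb R^n$ (so $K\ge1$). $\mathcal K(X)$ is the set of kernels of hyperbolic type on $X$. The critical exponent $t_K\in[1,\infty]$ of $K\in\mathcal K(X)$ is the supremum of $t\in[1,\infty)$ such that $K^t$ is a kernel of hyperbolic type. (For $K\in\mathcal K(X)$ and $t\in[0,1]$ one always has $K^t\in\mathcal K(X)$.) $K$ is arboreal when there are a real tree $(T,d)$ and a function $f\colon X\to T$ such that $K(x,y)=\exp d(f(x),f(y))$ for all $x,y\in X$. A real tree is a metric space in which any two points are joined by a unique injective segment, these segments being isometric to intervals. *)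

theory Defs
  imports "HOL-Analysis.Analysis"
begin

section \<open>Kernels of hyperbolic type\<close>

definition kernel :: "'a topology \<Rightarrow> ('a \<Rightarrow> 'a \<Rightarrow> real) \<Rightarrow> bool" where
  "kernel X K \<longleftrightarrow>
     continuous_map (prod_topology X X) euclideanreal (\<lambda>(x, y). K x y) \<and>
     (\<forall>x\<in>topspace X. \<forall>y\<in>topspace X. K x y = K y x)"

definition hyperbolic_kernel :: "'a topology \<Rightarrow> ('a \<Rightarrow> 'a \<Rightarrow> real) \<Rightarrow> bool" where
  "hyperbolic_kernel X K \<longleftrightarrow>
     kernel X K \<and>
     (\<forall>x\<in>topspace X. \<forall>y\<in>topspace X. 0 \<le> K x y) \<and>
     (\<forall>x\<in>topspace X. K x x = 1) \<and>
     (\<forall>(n::nat) (x :: nat \<Rightarrow> 'a) (c :: nat \<Rightarrow> real).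
        (\<forall>i\<in>{0..n}. x i \<in> topspace X) \<longrightarrow>
        (\<Sum>i=1..n. \<Sum>j=1..n. c i * c j * K (x i) (x j)) \<le> (\<Sum>k=1..n. c k * K (x 0) (x k))\<^sup>2)"

definition critical_exponent :: "'a topology \<Rightarrow> ('a \<Rightarrow> 'a \<Rightarrow> real) \<Rightarrow> ereal" where
  "critical_exponent X K =
     (SUP t \<in> {t::real. 1 \<le> t \<and> hyperbolic_kernel X (\<lambda>x y. K x y powr t)}. ereal t)"


section \<open>Real trees\<close>

definition injective_segment ::
    "'b set \<Rightarrow> ('b \<Rightarrow> 'b \<Rightarrow> real) \<Rightarrow> 'b \<Rightarrow> 'b \<Rightarrow> 'b set \<Rightarrow> bool" where
  "injective_segment M d x y S \<longleftrightarrow>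
     (\<exists>g. pathin (Metric_space.mtopology M d) g \<and> inj_on g {0..1} \<and>
          g 0 = x \<and> g 1 = y \<and> S = g ` {0..1})"

definition isometric_to_interval :: "('b \<Rightarrow> 'b \<Rightarrow> real) \<Rightarrow> 'b set \<Rightarrow> bool" where
  "isometric_to_interval d S \<longleftrightarrow>
     (\<exists>(a::real) b g. g ` {a..b} = S \<and> (\<forall>s\<in>{a..b}. \<forall>t\<in>{a..b}. d (g s) (g t) = \<bar>s - t\<bar>))"

text \<open>
  Segments are images of paths, so that uniqueness disregards the parametrisation. Paths are
  parametrised by the unit interval; the two end points are therefore required to be distinct,
  as the degenerate segment from a point to itself is not the image of an injective path.
\<close>

definition real_tree :: "'b set \<Rightarrow> ('b \<Rightarrow> 'b \<Rightarrow> real) \<Rightarrow> bool" where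
  "real_tree M d \<longleftrightarrow>
     Metric_space M d \<and>
     (\<forall>x\<in>M. \<forall>y\<in>M. x \<noteq> y \<longrightarrow>
        (\<exists>!S. injective_segment M d x y S) \<and>
        (\<forall>S. injective_segment M d x y S \<longrightarrow> isometric_to_interval d S))"


section \<open>Arboreal kernels\<close>

text \<open>
  A HOL formula cannot quantify over all types, so the real tree is sought among the subsets
  of one fixed type. The type \<open>'a \<times> real\<close> is large enough to entail no loss of generality:
  this is the lemma \<open>arborealI\<close> below.
\<close>

definition arboreal :: "'a topology \<Rightarrow> ('a \<Rightarrow> 'a \<Rightarrow> real) \<Rightarrow> bool" where
  "arboreal X K \<longleftrightarrow>
     (\<exists>(T :: ('a \<times> real) set) d f.
        real_tree T d \<and> f \<in> topspace X \<rightarrow> T \<and>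
        (\<forall>x\<in>topspace X. \<forall>y\<in>topspace X. K x y = exp (d (f x) (f y))))"

lemma real_tree_pullback:
  fixes \<phi> :: "'c \<Rightarrow> 'b"
  assumes T: "real_tree M d" and im: "\<phi> ` N \<subseteq> M" and inj: "inj_on \<phi> N"
    and conv: "\<And>x y S. \<lbrakk>x \<in> \<phi> ` N; y \<in> \<phi> ` N; x \<noteq> y; injective_segment M d x y S\<rbrakk> \<Longrightarrow> S \<subseteq> \<phi> ` N"
  shows "real_tree N (\<lambda>p q. d (\<phi> p) (\<phi> q))"
proof -
  let ?e = "\<lambda>p q. d (\<phi> p) (\<phi> q)"
  let ?\<psi> = "inv_into N \<phi>"
  interpret M: Metric_space M d using T by (simp add: real_tree_def)
  interpret N: Metric_space N ?e
  proof
    show "?e x y = ?e y x" for x y by (rule M.commute)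
    show "?e x y = 0 \<longleftrightarrow> x = y" if "x \<in> N" "y \<in> N" for x y
      using that im inj M.zero[of "\<phi> x" "\<phi> y"] by (metis image_subset_iff inj_onD)
    show "?e x z \<le> ?e x y + ?e y z" if "x \<in> N" "y \<in> N" "z \<in> N" for x y z
      using that im by (intro M.triangle) auto
  qed auto
  interpret Metric_space12 N ?e M d ..
  have emb: "embedding_map N.mtopology M.mtopology \<phi>"
    using im by (intro isometry_imp_embedding_map) auto
  then obtain \<psi>' where hm: "homeomorphic_maps N.mtopology (subtopology M.mtopology (\<phi> ` N)) \<phi> \<psi>'"
    by (auto simp: embedding_map_def homeomorphic_map_maps)
  have c\<phi>: "continuous_map N.mtopology M.mtopology \<phi>"
    using hm by (auto simp: homeomorphic_maps_def continuous_map_in_subtopology)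
  have \<psi>'eq: "\<psi>' z = ?\<psi> z" if "z \<in> \<phi> ` N" for z
    using that hm inj by (auto simp: homeomorphic_maps_def inv_into_f_f)
  have c\<psi>: "continuous_map (subtopology M.mtopology (\<phi> ` N)) N.mtopology ?\<psi>"
    by (rule continuous_map_eq[of _ _ \<psi>']) (use hm \<psi>'eq in \<open>auto simp: homeomorphic_maps_def\<close>)
  have fwd: "injective_segment M d (\<phi> p) (\<phi> q) (\<phi> ` S) \<and> S \<subseteq> N"
    if S: "injective_segment N ?e p q S" for p q S
  proof -
    obtain g where g: "pathin N.mtopology g" "inj_on g {0..1}" "g 0 = p" "g 1 = q" "S = g ` {0..1}"
      using S by (auto simp: injective_segment_def)
    have sub: "g ` {0..1} \<subseteq> N" using path_image_subset_topspace[OF g(1)] by auto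
    have "inj_on (\<phi> \<circ> g) {0..1}"
      using g(2) sub inj by (meson comp_inj_on inj_on_subset)
    then show ?thesis
      using g sub pathin_compose[OF g(1) c\<phi>]
      unfolding injective_segment_def by (intro conjI exI[of _ "\<phi> \<circ> g"]) (auto simp: image_comp)
  qed
  have bwd: "injective_segment N ?e p q (?\<psi> ` R) \<and> R \<subseteq> \<phi> ` N"
    if pq: "p \<in> N" "q \<in> N" "p \<noteq> q" and R: "injective_segment M d (\<phi> p) (\<phi> q) R" for p q R
  proof -
    have ne: "\<phi> p \<noteq> \<phi> q" using pq inj by (auto dest: inj_onD)
    have sub: "R \<subseteq> \<phi> ` N" using conv[OF _ _ ne R] pq by blast
    obtain g where g: "pathin M.mtopology g" "inj_on g {0..1}" "g 0 = \<phi> p" "g 1 = \<phi> q" "R = g ` {0..1}"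
      using R by (auto simp: injective_segment_def)
    have "pathin (subtopology M.mtopology (\<phi> ` N)) g"
      using g sub by (auto simp: pathin_subtopology)
    then have "pathin N.mtopology (?\<psi> \<circ> g)" using c\<psi> by (rule pathin_compose)
    moreover have "inj_on (?\<psi> \<circ> g) {0..1}"
      using g sub inj_on_subset[OF inj_on_inv_into[of "\<phi> ` N" \<phi> N]] by (intro comp_inj_on) auto
    ultimately show ?thesis
      using g sub pq inj unfolding injective_segment_def
      by (intro conjI exI[of _ "?\<psi> \<circ> g"]) (auto simp: image_comp)
  qed
  have "(\<exists>!S. injective_segment N ?e p q S) \<and>
        (\<forall>S. injective_segment N ?e p q S \<longrightarrow> isometric_to_interval ?e S)"
    if pq: "p \<in> N" "q \<in> N" "p \<noteq> q" for p q
  proof -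
    have ne: "\<phi> p \<in> M" "\<phi> q \<in> M" "\<phi> p \<noteq> \<phi> q" using pq im inj by (auto dest: inj_onD)
    have ex: "\<exists>!R. injective_segment M d (\<phi> p) (\<phi> q) R"
      and iso: "\<And>R. injective_segment M d (\<phi> p) (\<phi> q) R \<Longrightarrow> isometric_to_interval d R"
      using T ne unfolding real_tree_def by blast+
    from ex obtain R where "injective_segment M d (\<phi> p) (\<phi> q) R" by blast
    then have 1: "injective_segment N ?e p q (?\<psi> ` R)" using bwd pq by blast
    have 2: "S = S'" if "injective_segment N ?e p q S" "injective_segment N ?e p q S'" for S S'
      using fwd[OF that(1)] fwd[OF that(2)] ex inj by (metis inj_on_image_eq_iff)
    have 3: "isometric_to_interval ?e S" if S: "injective_segment N ?e p q S" for S
    proof -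
      obtain a b :: real and g where g: "g ` {a..b} = \<phi> ` S"
        "\<And>s t. s \<in> {a..b} \<Longrightarrow> t \<in> {a..b} \<Longrightarrow> d (g s) (g t) = \<bar>s - t\<bar>"
        using iso[of "\<phi> ` S"] fwd[OF S] unfolding isometric_to_interval_def by metis
      have SN: "S \<subseteq> N" using fwd[OF S] by blast
      have "(?\<psi> \<circ> g) ` {a..b} = S"
        using g(1) SN inj by (metis image_comp inv_into_image_cancel)
      moreover have "\<phi> ((?\<psi> \<circ> g) s) = g s" if "s \<in> {a..b}" for s
      proof -
        have "g s \<in> \<phi> ` N" using that g(1) SN by blast
        then show ?thesis by (simp add: f_inv_into_f)
      qed
      ultimately show ?thesis
        using g(2) unfolding isometric_to_interval_def by (intro exI[of _ a] exI[of _ b] exI[of _ "?\<psi> \<circ> g"]) auto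
    qed
    show ?thesis using 1 2 3 by blast
  qed
  then show ?thesis using N.Metric_space_axioms by (simp add: real_tree_def)
qed

text \<open>
  Iterating the operation of adding all segments between given points, starting from the
  image of \<open>X\<close>, gives a subtree whose cardinality is at most that of \<open>'a \<times> real\<close>.
\<close>

lemma arborealI:
  includes cardinal_syntax
  fixes X :: "'a topology" and T :: "'b set"
  assumes T: "real_tree T d" and f: "f \<in> topspace X \<rightarrow> T"
    and K: "\<And>x y. \<lbrakk>x \<in> topspace X; y \<in> topspace X\<rbrakk> \<Longrightarrow> K x y = exp (d (f x) (f y))"
  shows "arboreal X K"
proof -
  let ?U = "UNIV :: ('a \<times> real) set"
  define seg where "seg p = \<Union>{S. injective_segment T d (fst p) (snd p) S \<and> fst p \<in> T \<and> snd p \<in> T \<and> fst p \<noteq> snd p}" for p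
  define A where "A = rec_nat (f ` topspace X) (\<lambda>_ B. B \<union> (\<Union>p\<in>B \<times> B. seg p))"
  define S where "S = (\<Union>n. A n)"
  have A0: "A 0 = f ` topspace X" and AS: "A (Suc n) = A n \<union> (\<Union>p\<in>A n \<times> A n. seg p)" for n
    by (simp_all add: A_def)
  interpret Metric_space T d using T by (simp add: real_tree_def)
  have infU: "infinite ?U"
    using infinite_UNIV_char_0[where 'a = real] by (simp add: finite_prod)
  have seg_sub: "seg p \<subseteq> T" for p
    using path_image_subset_topspace
    by (fastforce simp: seg_def injective_segment_def)
  have A_sub: "A n \<subseteq> T" for n
  proof (induction n)
    case 0
    show ?case using f by (auto simp: A0)
  next
    case (Suc n)
    then show ?case using seg_sub unfolding AS by blast
  qed
  have seg_card: "|seg p| \<le>o |?U|" for p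
  proof -
    have "\<exists>g :: real \<Rightarrow> 'b. seg p \<subseteq> range g"
    proof (cases "seg p = {}")
      case False
      then have p: "fst p \<in> T" "snd p \<in> T" "fst p \<noteq> snd p" by (auto simp: seg_def)
      then have "\<exists>!S. injective_segment T d (fst p) (snd p) S" using T by (simp add: real_tree_def)
      then obtain S where S: "injective_segment T d (fst p) (snd p) S"
        "\<And>S'. injective_segment T d (fst p) (snd p) S' \<Longrightarrow> S' = S" by blast
      then have "seg p \<subseteq> S" unfolding seg_def by blast
      then show ?thesis using S(1) unfolding injective_segment_def by (metis image_mono subset_UNIV order_trans)
    qed auto
    then obtain g :: "real \<Rightarrow> 'b" where "seg p \<subseteq> range g" by blast
    then have "|seg p| \<le>o |UNIV :: real set|"
      by (meson card_of_image card_of_mono1 ordLeq_transitive)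
    moreover have "|UNIV :: real set| \<le>o |?U|"
      by (rule card_of_ordLeq[THEN iffD1], rule exI[of _ "\<lambda>r. (undefined, r)"]) (auto simp: inj_on_def)
    ultimately show ?thesis by (rule ordLeq_transitive)
  qed
  have A_card: "|A n| \<le>o |?U|" for n
  proof (induction n)
    case 0
    have "|f ` topspace X| \<le>o |topspace X|" by (rule card_of_image)
    also have "|topspace X| \<le>o |?U|"
      by (rule card_of_ordLeq[THEN iffD1], rule exI[of _ "\<lambda>x. (x, 0)"]) (auto simp: inj_on_def)
    finally show ?case by (simp add: A0)
  next
    case (Suc n)
    have "|\<Union>y\<in>A n. seg (x, y)| \<le>o |?U|" for x
      using Suc seg_card by (intro card_of_UNION_ordLeq_infinite[OF infU]) auto
    then have "|\<Union>x\<in>A n. \<Union>y\<in>A n. seg (x, y)| \<le>o |?U|"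
      using Suc by (intro card_of_UNION_ordLeq_infinite[OF infU]) auto
    moreover have "(\<Union>p\<in>A n \<times> A n. seg p) = (\<Union>x\<in>A n. \<Union>y\<in>A n. seg (x, y))" by auto
    ultimately show ?case
      using Suc infU unfolding AS by (intro card_of_Un_ordLeq_infinite_Field) (simp_all add: card_of_card_order_on Field_card_of)
  qed
  have "|S| \<le>o |?U|"
    unfolding S_def
  proof (rule card_of_UNION_ordLeq_infinite[OF infU])
    show "|UNIV :: nat set| \<le>o |?U|" using infU by (simp add: infinite_iff_card_of_nat)
  qed (use A_card in auto)
  then obtain h :: "'b \<Rightarrow> 'a \<times> real" where h: "inj_on h S"
    unfolding card_of_ordLeq[symmetric] by blast
  define \<phi> where "\<phi> = inv_into S h"
  have \<phi>h: "\<phi> (h z) = z" if "z \<in> S" for z using h that by (simp add: \<phi>_def)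
  have im: "\<phi> ` h ` S = S" using \<phi>h by force
  have inj: "inj_on \<phi> (h ` S)" by (metis \<phi>_def inj_on_inv_into order_refl)
  have mono: "A m \<subseteq> A n" if "m \<le> n" for m n
    using that by (rule lift_Suc_mono_le[rotated]) (simp add: AS)
  have ST: "S \<subseteq> T" using A_sub by (auto simp: S_def)
  have "real_tree (h ` S) (\<lambda>p q. d (\<phi> p) (\<phi> q))"
  proof (rule real_tree_pullback[OF T _ inj]; unfold im)
    show "S \<subseteq> T" by (rule ST)
    fix x y R assume xy: "x \<in> S" "y \<in> S" "x \<noteq> y" and R: "injective_segment T d x y R"
    obtain m n where "x \<in> A m" "y \<in> A n" using xy by (auto simp: S_def)
    then have "x \<in> A (max m n)" "y \<in> A (max m n)"
      using mono[of m "max m n"] mono[of n "max m n"] by auto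
    then have "seg (x, y) \<subseteq> A (Suc (max m n))" by (auto simp: AS)
    moreover have "R \<subseteq> seg (x, y)" using R xy ST by (auto simp: seg_def)
    ultimately show "R \<subseteq> S" by (auto simp: S_def)
  qed
  moreover have fS: "f x \<in> S" if "x \<in> topspace X" for x
    using that A0 by (auto simp: S_def)
  ultimately show ?thesis
    unfolding arboreal_def
    by (intro exI[of _ "h ` S"] exI[of _ "\<lambda>p q. d (\<phi> p) (\<phi> q)"] exI[of _ "h \<circ> f"])
       (auto simp: \<phi>h K)
qed

end

theory Submission
  imports Defs
begin

text \<open>
  Both conditions say that \<open>d = ln K\<close> satisfies the four-point condition. Testing the hyperbolic
  inequality for \<open>K\<^sup>t\<close> on four points gives
  \<open>K(x,y)\<^sup>t K(z,w)\<^sup>t \<le> 2 (K(x,z)\<^sup>t K(y,w)\<^sup>t + K(x,w)\<^sup>t K(y,z)\<^sup>t)\<close>, and the factor 2 and the sum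
  disappear in the \<open>t\<close>-th root as \<open>t\<close> tends to infinity; a space with the four-point condition embeds
  into a real tree. Conversely, in a real tree the Gromov product satisfies
  \<open>(x|y) \<ge> min (x|z) (z|y)\<close>, hence so does \<open>1 - exp (-2t(x|y))\<close>, and a nonnegative symmetric matrix
  with this property is positive semidefinite; this is the hyperbolic inequality for \<open>exp (t d)\<close>.
\<close>

section \<open>The four-point condition\<close>

definition four_point :: "'b set \<Rightarrow> ('b \<Rightarrow> 'b \<Rightarrow> real) \<Rightarrow> bool" where
  "four_point M d \<longleftrightarrow>
     (\<forall>x\<in>M. \<forall>y\<in>M. \<forall>z\<in>M. \<forall>w\<in>M. d x y + d z w \<le> max (d x z + d y w) (d x w + d y z))"

definition gromov_product :: "('b \<Rightarrow> 'b \<Rightarrow> real) \<Rightarrow> 'b \<Rightarrow> 'b \<Rightarrow> 'b \<Rightarrow> real" where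
  "gromov_product d w x y = (d w x + d w y - d x y) / 2"

text \<open>Written out, the two inequalities agree for each quadruple separately. Only symmetry of
  \<open>d\<close> is assumed, so that the lemma also serves functions vanishing at distinct
  points.\<close>

lemma four_point_iff_gromov_product:
  assumes "\<And>x y. d x y = d y x"
  shows "four_point M d \<longleftrightarrow>
     (\<forall>w\<in>M. \<forall>x\<in>M. \<forall>y\<in>M. \<forall>z\<in>M.
        min (gromov_product d w x z) (gromov_product d w z y) \<le> gromov_product d w x y)"
proof -
  have "(d x y + d z w \<le> max (d x z + d y w) (d x w + d y z)) \<longleftrightarrow>
        min (gromov_product d w x z) (gromov_product d w z y) \<le> gromov_product d w x y" for x y z w
    using assms[of z w] assms[of y w] assms[of x w] assms[of y z]
    by (auto simp: gromov_product_def min_def max_def field_simps)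
  then show ?thesis unfolding four_point_def by blast
qed

context Metric_space
begin

lemma four_point_gromov_product:
  assumes "four_point M d" "w \<in> M" "x \<in> M" "y \<in> M" "z \<in> M"
    and "r \<le> gromov_product d w x z" "r \<le> gromov_product d w z y"
  shows "r \<le> gromov_product d w x y"
proof -
  have "min (gromov_product d w x z) (gromov_product d w z y) \<le> gromov_product d w x y"
    using assms by (simp add: four_point_iff_gromov_product[OF commute])
  then show ?thesis using assms(6,7) by linarith
qed

text \<open>An affine change of parameter turns \<open>h\<close> into a path on the unit interval. A
  Lipschitz bound is assumed instead of an isometry because the lemma is also applied to two
  geodesics joined end to end, of which no more is known at that stage.\<close>

lemma lipschitz_injective_segment:
  fixes h :: "real \<Rightarrow> 'a"
  assumes uv: "u < v" and h: "\<And>s. s \<in> {u..v} \<Longrightarrow> h s \<in> M"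
    and lip: "\<And>s t. \<lbrakk>u \<le> s; s \<le> t; t \<le> v\<rbrakk> \<Longrightarrow> d (h s) (h t) \<le> t - s"
    and inj: "inj_on h {u..v}"
  shows "injective_segment M d (h u) (h v) (h ` {u..v})"
proof -
  define a where "a t = u + t * (v - u)" for t
  have a_im: "a ` {0..1} = {u..v}"
  proof
    show "a ` {0..1} \<subseteq> {u..v}"
    proof
      fix y assume "y \<in> a ` {0..1}"
      then obtain t where t: "0 \<le> t" "t \<le> 1" "y = u + t * (v - u)" by (auto simp: a_def)
      have "0 \<le> t * (v - u)" "t * (v - u) \<le> 1 * (v - u)"
        using t uv by (auto intro!: mult_right_mono mult_nonneg_nonneg)
      then show "y \<in> {u..v}" using t by simp
    qed
    show "{u..v} \<subseteq> a ` {0..1}"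
    proof
      fix y assume "y \<in> {u..v}"
      then show "y \<in> a ` {0..1}"
        using uv by (intro image_eqI[of _ _ "(y - u) / (v - u)"]) (auto simp: a_def field_simps)
    qed
  qed
  have lip': "d (h s) (h t) \<le> \<bar>t - s\<bar>" if "s \<in> {u..v}" "t \<in> {u..v}" for s t
    using lip[of s t] lip[of t s] that commute[of "h s" "h t"] by (cases "s \<le> t") auto
  have a_in: "a t \<in> {u..v}" if "t \<in> {0..1}" for t using a_im that by blast
  have inj_a: "inj_on a {0..1}" using uv by (auto simp: a_def inj_on_def)
  have "continuous_map (top_of_set {0..1}) mtopology (h \<circ> a)"
    unfolding continuous_map_to_metric
  proof (intro ballI allI impI)
    fix t \<epsilon> :: real
    assume "t \<in> topspace (top_of_set {0..1})" and \<epsilon>: "0 < \<epsilon>"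
    then have t: "t \<in> {0..1}" by simp
    let ?U = "{0..1} \<inter> ball t (\<epsilon> / (v - u))"
    have "(h \<circ> a) s \<in> mball ((h \<circ> a) t) \<epsilon>" if s: "s \<in> ?U" for s
    proof -
      have "d (h (a t)) (h (a s)) \<le> \<bar>a s - a t\<bar>"
        using s t a_in by (intro lip') auto
      also have "\<dots> = \<bar>s - t\<bar> * (v - u)"
        using uv by (simp add: a_def abs_mult flip: left_diff_distrib)
      also have "\<dots> < \<epsilon>"
        using s uv by (auto simp: dist_real_def field_simps abs_minus_commute)
      finally show ?thesis using s t a_in h by simp
    qed
    moreover have "openin (top_of_set {0..1}) ?U" by (auto simp: openin_open)
    moreover have "t \<in> ?U" using t \<epsilon> uv by auto
    ultimately show "\<exists>U. openin (top_of_set {0..1}) U \<and> t \<in> U \<and>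
        (\<forall>y\<in>U. (h \<circ> a) y \<in> mball ((h \<circ> a) t) \<epsilon>)"
      by blast
  qed
  moreover have "inj_on (h \<circ> a) {0..1}"
    using inj inj_a a_im by (simp add: comp_inj_on)
  moreover have "(h \<circ> a) ` {0..1} = h ` {u..v}" using a_im by (metis image_comp)
  moreover have "(h \<circ> a) 0 = h u" "(h \<circ> a) 1 = h v" by (simp_all add: a_def)
  ultimately show ?thesis unfolding injective_segment_def pathin_def by metis
qed

text \<open>Parametrised by arc length from \<open>x\<close>. Unlike
  \<open>injective_segment\<close> this includes the case \<open>x = y\<close>, where the domain is
  the single point 0.\<close>

definition geodesic :: "'a \<Rightarrow> 'a \<Rightarrow> (real \<Rightarrow> 'a) \<Rightarrow> bool" where
  "geodesic x y g \<longleftrightarrow> g 0 = x \<and> g (d x y) = y \<and> (\<forall>s\<in>{0..d x y}. g s \<in> M) \<and>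
     (\<forall>s\<in>{0..d x y}. \<forall>t\<in>{0..d x y}. d (g s) (g t) = \<bar>s - t\<bar>)"

lemma geodesic_dist:
  assumes "geodesic x y g" "0 \<le> s" "s \<le> d x y"
  shows "d x (g s) = s" "d (g s) y = d x y - s"
proof -
  have g: "g 0 = x" "g (d x y) = y"
    and iso: "\<And>a b. \<lbrakk>a \<in> {0..d x y}; b \<in> {0..d x y}\<rbrakk> \<Longrightarrow> d (g a) (g b) = \<bar>a - b\<bar>"
    using assms(1) by (auto simp: geodesic_def)
  show "d x (g s) = s" using iso[of 0 s] assms(2,3) unfolding g by simp
  show "d (g s) y = d x y - s" using iso[of s "d x y"] assms(2,3) unfolding g by simp
qed

lemma geodesic_inj:
  assumes "geodesic x y g"
  shows "inj_on g {0..d x y}"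
proof (rule inj_onI)
  fix s t assume st: "s \<in> {0..d x y}" "t \<in> {0..d x y}" "g s = g t"
  have "s = d x (g s)" using geodesic_dist(1)[OF assms, of s] st(1) by simp
  also have "\<dots> = t" using geodesic_dist(1)[OF assms, of t] st(2) unfolding st(3) by simp
  finally show "s = t" .
qed

lemma geodesic_injective_segment:
  assumes "geodesic x y g" "x \<in> M" "y \<in> M" "x \<noteq> y"
  shows "injective_segment M d x y (g ` {0..d x y})"
proof -
  have pos: "0 < d x y" using assms by simp
  have "injective_segment M d (g 0) (g (d x y)) (g ` {0..d x y})"
    using assms pos by (intro lipschitz_injective_segment geodesic_inj) (auto simp: geodesic_def)
  then show ?thesis using assms(1) by (simp add: geodesic_def)
qed

end

section \<open>Real trees satisfy the four-point condition\<close>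

context Metric_space
begin

text \<open>
  The isometry onto an interval is not assumed to respect the end points. If it did not, the part
  of the interval between the parameters of \<open>x\<close> and \<open>y\<close> would yield a second segment.
\<close>

lemma real_tree_segment:
  assumes T: "real_tree M d" and xy: "x \<in> M" "y \<in> M" "x \<noteq> y"
    and S: "injective_segment M d x y S"
  shows "\<exists>g. geodesic x y g \<and> S = g ` {0..d x y}"
proof -
  obtain a b g where g: "g ` {a..b} = S" and
    iso: "\<And>s t. s \<in> {a..b} \<Longrightarrow> t \<in> {a..b} \<Longrightarrow> d (g s) (g t) = \<bar>s - t\<bar>"
    using T S xy unfolding real_tree_def isometric_to_interval_def by metis
  have SM: "S \<subseteq> M"
    using S path_image_subset_topspace by (fastforce simp: injective_segment_def)
  have xyS: "x \<in> S" "y \<in> S" using S by (force simp: injective_segment_def)+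
  obtain u v where uv: "u \<in> {a..b}" "v \<in> {a..b}" "x = g u" "y = g v" using xyS g by blast
  have "u \<noteq> v" using uv xy by auto
  \<comment> \<open>The interval may be traversed from \<open>y\<close> to \<open>x\<close>; the
    sign corrects the orientation.\<close>
  define \<sigma> :: real where "\<sigma> = (if u < v then 1 else -1)"
  define h where "h s = g (u + \<sigma> * s)" for s
  have dxy: "d x y = \<bar>u - v\<bar>" using uv iso by simp
  have v: "v = u + \<sigma> * d x y" using \<open>u \<noteq> v\<close> by (auto simp: dxy \<sigma>_def)
  have dom: "u + \<sigma> * s \<in> {a..b}" if "s \<in> {0..d x y}" for s
    using that uv(1,2) unfolding dxy by (cases "u < v") (simp_all add: \<sigma>_def)
  have geo: "geodesic x y h"
    unfolding geodesic_def
  proof (intro conjI ballI)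
    show "h 0 = x" using uv(3) by (simp add: h_def)
    show "h (d x y) = y" using v uv(4) unfolding h_def by metis
    show "h s \<in> M" if "s \<in> {0..d x y}" for s
      using dom[OF that] g SM unfolding h_def by blast
    show "d (h s) (h t) = \<bar>s - t\<bar>" if "s \<in> {0..d x y}" "t \<in> {0..d x y}" for s t
      using iso[OF dom dom, OF that] unfolding h_def by (simp add: \<sigma>_def abs_minus_commute split: if_splits)
  qed
  have "\<exists>!S. injective_segment M d x y S" using T xy by (simp add: real_tree_def)
  then have "S = h ` {0..d x y}"
    using S geodesic_injective_segment[OF geo xy] by blast
  then show ?thesis using geo by blast
qed

lemma real_tree_geodesic:
  assumes "real_tree M d" "x \<in> M" "y \<in> M"
  shows "\<exists>g. geodesic x y g"
proof (cases "x = y")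
  case True
  then show ?thesis using assms by (auto simp: geodesic_def)
next
  case False
  then have "\<exists>!S. injective_segment M d x y S" using assms by (simp add: real_tree_def)
  then obtain S where "injective_segment M d x y S" by blast
  then show ?thesis using real_tree_segment[OF assms False] by blast
qed

text \<open>The parameters at which the geodesics agree form a closed set containing 0, so their
  supremum is attained.\<close>

lemma geodesics_branch_point:
  assumes gx: "geodesic p x g" and gy: "geodesic p y h" and p: "p \<in> M" "x \<in> M" "y \<in> M"
  obtains r where "0 \<le> r" "r \<le> d p x" "r \<le> d p y" "g r = h r"
    "\<And>s. \<lbrakk>r < s; s \<le> d p x; s \<le> d p y\<rbrakk> \<Longrightarrow> g s \<noteq> h s"
proof -
  define R where "R = {s. 0 \<le> s \<and> s \<le> d p x \<and> s \<le> d p y \<and> g s = h s}"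
  have R0: "0 \<in> R" using gx gy by (auto simp: R_def geodesic_def)
  have bdd: "bdd_above R" by (auto simp: R_def intro!: bdd_aboveI[of _ "d p x"])
  let ?r = "Sup R"
  have r: "0 \<le> ?r" "?r \<le> d p x" "?r \<le> d p y"
    using R0 bdd by (auto intro!: cSup_upper cSup_least) (auto simp: R_def)
  have gM: "g ?r \<in> M" "h ?r \<in> M" using r gx gy by (auto simp: geodesic_def)
  have "g ?r = h ?r"
  proof (rule ccontr)
    assume "g ?r \<noteq> h ?r"
    then have "0 < d (g ?r) (h ?r)" using gM by simp
    \<comment> \<open>Between \<open>s\<close> and the supremum each geodesic moves by less than
      half of the supposed gap, yet they agree at \<open>s\<close>.\<close>
    then obtain s where s: "s \<in> R" "?r - d (g ?r) (h ?r) / 2 < s"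
      using less_cSup_iff[of R "?r - d (g ?r) (h ?r) / 2"] R0 bdd by auto
    have "s \<le> ?r" using s bdd by (simp add: cSup_upper)
    moreover have "s \<in> {0..d p x}" "s \<in> {0..d p y}" "?r \<in> {0..d p x}" "?r \<in> {0..d p y}"
      using s(1) r by (auto simp: R_def)
    then have "d (g ?r) (g s) = \<bar>?r - s\<bar>" "d (h s) (h ?r) = \<bar>s - ?r\<bar>" "g s \<in> M"
      using gx gy unfolding geodesic_def by blast+
    moreover have "g s = h s" using s(1) by (simp add: R_def)
    moreover have "d (g ?r) (h ?r) \<le> d (g ?r) (g s) + d (g s) (h ?r)"
      using gM \<open>g s \<in> M\<close> by (intro triangle)
    ultimately show False using s by simp
  qed
  moreover have "g s \<noteq> h s" if "?r < s" "s \<le> d p x" "s \<le> d p y" for s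
    using that r cSup_upper[of s R] bdd by (auto simp: R_def)
  ultimately show ?thesis using that r by blast
qed

text \<open>
  Beyond the branch point the two geodesics are disjoint, so together they form a segment from
  \<open>x\<close> to \<open>y\<close>; its being a geodesic locates the branch point at distance \<open>(x|y)\<^sub>p\<close> from \<open>p\<close>.
\<close>

lemma real_tree_geodesics_agree:
  assumes T: "real_tree M d" and p: "p \<in> M" "x \<in> M" "y \<in> M"
    and gx: "geodesic p x g" and gy: "geodesic p y h" and xy: "x \<noteq> y"
    and s: "0 \<le> s" "s \<le> gromov_product d p x y"
  shows "g s = h s"
proof -
  obtain r where r: "0 \<le> r" "r \<le> d p x" "r \<le> d p y" "g r = h r"
    and above: "\<And>s. \<lbrakk>r < s; s \<le> d p x; s \<le> d p y\<rbrakk> \<Longrightarrow> g s \<noteq> h s"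
    using geodesics_branch_point[OF gx gy p] by metis
  let ?m = "g r"
  have m: "?m \<in> M"
  proof -
    have "r \<in> {0..d p x}" using r by simp
    then show ?thesis using gx unfolding geodesic_def by blast
  qed
  \<comment> \<open>\<open>k\<close> runs backwards along \<open>g\<close> from \<open>x\<close> to
    the branch point, reached at parameter 0, and then along \<open>h\<close> to
    \<open>y\<close>.\<close>
  define k where "k t = (if t \<le> 0 then g (r - t) else h (r + t))" for t
  let ?u = "r - d p x" and ?v = "d p y - r"
  \<comment> \<open>The parameter is the distance from \<open>p\<close>, so the two geodesics can
    only meet at equal parameters.\<close>
  have param: "a = b" if "a \<in> {0..d p x}" "b \<in> {0..d p y}" "g a = h b" for a b
    using geodesic_dist(1)[OF gx, of a] geodesic_dist(1)[OF gy, of b] that by auto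
  have gg: "d (g a) (g b) = \<bar>a - b\<bar>" if "a \<in> {0..d p x}" "b \<in> {0..d p x}" for a b
    using gx that by (auto simp: geodesic_def)
  have hh: "d (h a) (h b) = \<bar>a - b\<bar>" if "a \<in> {0..d p y}" "b \<in> {0..d p y}" for a b
    using gy that by (auto simp: geodesic_def)
  have gM: "g a \<in> M" if "a \<in> {0..d p x}" for a using gx that by (auto simp: geodesic_def)
  have hM: "h a \<in> M" if "a \<in> {0..d p y}" for a using gy that by (auto simp: geodesic_def)
  have cross: False if "a \<in> {?u..0}" "b \<in> {0<..?v}" "g (r - a) = h (r + b)" for a b
  proof -
    have "r - a = r + b" using that r by (intro param) auto
    then show False using above[of "r + b"] that r by auto
  qed
  have "?u < ?v"
  proof (rule ccontr)
    assume "\<not> ?u < ?v"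
    then have "d p x = r" "d p y = r" using r by auto
    then show False using r gx gy xy by (auto simp: geodesic_def)
  qed
  have "injective_segment M d (k ?u) (k ?v) (k ` {?u..?v})"
  proof (rule lipschitz_injective_segment[OF \<open>?u < ?v\<close>])
    show "k t \<in> M" if "t \<in> {?u..?v}" for t
      using that r by (auto simp: k_def intro: gM hM)
    show "d (k a) (k b) \<le> b - a" if "?u \<le> a" "a \<le> b" "b \<le> ?v" for a b
    proof -
      consider "b \<le> 0" | "0 < a" | "a \<le> 0" "0 < b" by linarith
      then show ?thesis
      proof cases
        case 3
        have "d (g (r - a)) (h (r + b)) \<le> d (g (r - a)) (g r) + d (g r) (h (r + b))"
          using that 3 r by (intro triangle gM hM) auto
        also have "\<dots> = b - a"
          using gg[of "r - a" r] hh[of r "r + b"] that 3 r by auto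
        finally show ?thesis using 3 by (simp add: k_def)
      qed (use that r gg[of "r - a" "r - b"] hh[of "r + a" "r + b"] in \<open>auto simp: k_def\<close>)
    qed
    show "inj_on k {?u..?v}"
    proof (rule inj_onI)
      fix a b assume ab: "a \<in> {?u..?v}" "b \<in> {?u..?v}" "k a = k b"
      consider "a \<le> 0" "b \<le> 0" | "0 < a" "0 < b" | "a \<le> 0" "0 < b" | "b \<le> 0" "0 < a" by linarith
      then show "a = b"
      proof cases
        case 1
        then have "r - a = r - b"
          using ab r by (intro inj_onD[OF geodesic_inj[OF gx]]) (auto simp: k_def)
        then show ?thesis by simp
      next
        case 2
        then have "r + a = r + b"
          using ab r by (intro inj_onD[OF geodesic_inj[OF gy]]) (auto simp: k_def)
        then show ?thesis by simp
      qed (use ab cross[of a b] cross[of b a] in \<open>auto simp: k_def\<close>)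
    qed
  qed
  moreover have "k ?u = x" using r gx by (auto simp: k_def geodesic_def)
  moreover have "k ?v = y"
  proof (cases "?v \<le> 0")
    case True
    then have "d p y = r" using r by simp
    then show ?thesis using r gy by (auto simp: k_def geodesic_def)
  qed (use gy in \<open>auto simp: k_def geodesic_def\<close>)
  ultimately have seg: "injective_segment M d x y (k ` {?u..?v})" by simp
  obtain g' where g': "geodesic x y g'" "k ` {?u..?v} = g' ` {0..d x y}"
    using real_tree_segment[OF T p(2,3) xy seg] by blast
  have "?m \<in> k ` {?u..?v}"
    using r by (intro image_eqI[of _ _ 0]) (auto simp: k_def)
  then obtain q where "q \<in> {0..d x y}" "?m = g' q" using g' by auto
  then have "d x ?m + d ?m y = d x y" using geodesic_dist[OF g'(1), of q] by simp
  moreover have "d ?m x = d p x - r" "d ?m y = d p y - r"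
    using geodesic_dist(2)[OF gx, of r] geodesic_dist(2)[OF gy, of r] r by auto
  ultimately have "r = gromov_product d p x y"
    using commute[of x ?m] by (simp add: gromov_product_def)
  then have "s \<le> r" using s by simp
  show ?thesis
  \<comment> \<open>Below the branch point the geodesics agree by uniqueness of the segment from
    \<open>p\<close> to \<open>?m\<close>, which is available for distinct end points only.\<close>
  proof (cases "p = ?m")
    case True
    then have "r = 0" using geodesic_dist(1)[OF gx, of r] r p m by auto
    then show ?thesis using \<open>s \<le> r\<close> s r by simp
  next
    case False
    have dm: "d p ?m = r" using geodesic_dist(1)[OF gx, of r] r by simp
    have "geodesic p ?m g" "geodesic p ?m h"
      using gx gy r dm by (auto simp: geodesic_def)
    then have "injective_segment M d p ?m (g ` {0..r})" "injective_segment M d p ?m (h ` {0..r})"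
      using geodesic_injective_segment[of p ?m] p m False dm by auto
    moreover have "\<exists>!S. injective_segment M d p ?m S"
      using T p m False by (simp add: real_tree_def)
    ultimately have "g ` {0..r} = h ` {0..r}" by blast
    moreover have "g s \<in> g ` {0..r}" using s \<open>s \<le> r\<close> by simp
    ultimately obtain s' where s': "s' \<in> {0..r}" "g s = h s'" by auto
    then have "s = s'" using s \<open>s \<le> r\<close> r by (intro param) auto
    then show ?thesis using s' by simp
  qed
qed

text \<open>At height \<open>?s\<close> the geodesics from \<open>p\<close> to \<open>x\<close>,
  \<open>z\<close> and \<open>y\<close> all pass through one point. A detour through it bounds
  \<open>d x y\<close> by \<open>d p x + d p y - 2 * ?s\<close>.\<close>

lemma real_tree_imp_four_point:
  assumes T: "real_tree M d"
  shows "four_point M d"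
  unfolding four_point_iff_gromov_product[OF commute]
proof (intro ballI)
  fix p x y z assume M: "p \<in> M" "x \<in> M" "y \<in> M" "z \<in> M"
  let ?s = "min (gromov_product d p x z) (gromov_product d p z y)"
  show "?s \<le> gromov_product d p x y"
  proof (cases "x = z \<or> z = y")
    case True
    then show ?thesis by auto
  next
    case False
    have le: "0 \<le> gromov_product d p a b" "gromov_product d p a b \<le> d p a" "gromov_product d p a b \<le> d p b"
      if "a \<in> M" "b \<in> M" for a b
      using that M triangle[of a p b] triangle[of p a b] triangle[of p b a] commute[of a b] commute[of a p]
      by (auto simp: gromov_product_def field_simps)
    obtain gx gy gz where g: "geodesic p x gx" "geodesic p y gy" "geodesic p z gz"
      using real_tree_geodesic[OF T] M by meson
    have s: "0 \<le> ?s" "?s \<le> d p x" "?s \<le> d p y" using le M by (auto simp: min_le_iff_disj)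
    have "gx ?s = gz ?s" "gz ?s = gy ?s"
      using real_tree_geodesics_agree[OF T _ _ _ g(1,3)] real_tree_geodesics_agree[OF T _ _ _ g(3,2)]
        False M s by auto
    then have "d x y \<le> d x (gx ?s) + d (gy ?s) y"
      using M s g by (metis (no_types, lifting) triangle geodesic_def atLeastAtMost_iff)
    then show ?thesis
      using geodesic_dist(2)[OF g(1) s(1,2)] geodesic_dist(2)[OF g(2) s(1,3)] commute[of x "gx ?s"]
      by (simp add: gromov_product_def field_simps)
  qed
qed

end

section \<open>Geodesic four-point spaces are real trees\<close>

context Metric_space
begin

definition geodesic_space :: bool where
  "geodesic_space \<longleftrightarrow> (\<forall>x\<in>M. \<forall>y\<in>M. \<exists>g. geodesic x y g)"

text \<open>Both \<open>z\<close> and \<open>z'\<close> have Gromov product \<open>d x z\<close>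
  with \<open>y\<close>, seen from \<open>x\<close>. Hence so large is their product with each
  other, which forces their distance to be 0.\<close>

lemma four_point_geodesic_unique:
  assumes F: "four_point M d" and M: "x \<in> M" "y \<in> M" "z \<in> M" "z' \<in> M"
    and z: "d x z + d z y = d x y" and z': "d x z' + d z' y = d x y" and eq: "d x z = d x z'"
  shows "z = z'"
proof -
  have "d x z \<le> gromov_product d x z z'"
    by (rule four_point_gromov_product[where z = y])
       (use F M z z' eq commute[of z' y] in \<open>auto simp: gromov_product_def\<close>)
  then have "d z z' \<le> 0" using eq by (simp add: gromov_product_def)
  then show ?thesis using M by (metis nonneg zero antisym)
qed

text \<open>A point between \<open>x\<close> and \<open>y\<close> coincides with the point of the
  geodesic at the same distance from \<open>x\<close>. The image is thus described independently of
  \<open>g\<close>.\<close>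

lemma geodesic_image:
  assumes F: "four_point M d" and M: "x \<in> M" "y \<in> M" and g: "geodesic x y g"
  shows "g ` {0..d x y} = {z \<in> M. d x z + d z y = d x y}"
proof
  show "g ` {0..d x y} \<subseteq> {z \<in> M. d x z + d z y = d x y}"
  proof clarify
    fix s assume s: "s \<in> {0..d x y}"
    then have "g s \<in> M" using g by (simp add: geodesic_def)
    moreover have "d x (g s) + d (g s) y = d x y"
      using geodesic_dist[OF g, of s] s by simp
    ultimately show "g s \<in> M \<and> d x (g s) + d (g s) y = d x y" ..
  qed
  show "{z \<in> M. d x z + d z y = d x y} \<subseteq> g ` {0..d x y}"
  proof clarify
    fix z assume z: "z \<in> M" "d x z + d z y = d x y"
    have s: "0 \<le> d x z" "d x z \<le> d x y" using z(2) nonneg[of x z] nonneg[of z y] by linarith+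
    have gz: "g (d x z) \<in> M" using g s unfolding geodesic_def by simp
    have "z = g (d x z)"
      by (rule four_point_geodesic_unique[OF F M z(1) gz z(2)])
         (simp_all add: geodesic_dist[OF g s])
    then show "z \<in> g ` {0..d x y}" using s by auto
  qed
qed

text \<open>Removing an interior point \<open>z\<close> of \<open>[x,y]\<close> separates \<open>x\<close> from \<open>y\<close>: the points \<open>p\<close> with
  \<open>(p|x)\<^sub>z > 0\<close> and those with \<open>(p|x)\<^sub>z = 0\<close> form two open sets.\<close>

lemma four_point_interval_subset_connectedin:
  assumes F: "four_point M d" and S: "connectedin mtopology S" and x: "x \<in> S" and y: "y \<in> S"
    and z: "z \<in> M" "d x z + d z y = d x y"
  shows "z \<in> S"
proof (rule ccontr)
  assume zS: "z \<notin> S"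
  have SM: "S \<subseteq> M" using S connectedin_subset_topspace by fastforce
  let ?U = "{p \<in> M. 0 < gromov_product d z p x}"
  let ?V = "{p \<in> M. p \<noteq> z \<and> gromov_product d z p x \<le> 0}"
  have xM: "x \<in> M" "y \<in> M" using x y SM by auto
  have U: "openin mtopology ?U"
    unfolding openin_mtopology
  proof (intro conjI allI impI)
    fix p assume "p \<in> ?U"
    then have p: "p \<in> M" "0 < gromov_product d z p x" by auto
    \<comment> \<open>The Gromov product with \<open>x\<close> is 1-Lipschitz in its other
      argument.\<close>
    have "mball p (gromov_product d z p x) \<subseteq> ?U"
    proof
      fix q assume "q \<in> mball p (gromov_product d z p x)"
      then have q: "q \<in> M" "d p q < gromov_product d z p x" by auto
      then show "q \<in> ?U"
        using p q z xM triangle[of z q p] triangle[of q p x] commute[of p q]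
        by (auto simp: gromov_product_def field_simps)
    qed
    then show "\<exists>r>0. mball p r \<subseteq> ?U" using p by blast
  qed auto
  have V: "openin mtopology ?V"
    unfolding openin_mtopology
  proof (intro conjI allI impI)
    fix p assume "p \<in> ?V"
    then have p: "p \<in> M" "p \<noteq> z" "gromov_product d z p x \<le> 0" by auto
    \<comment> \<open>For \<open>d p q < d p z\<close> the product of \<open>p\<close> and
      \<open>q\<close> seen from \<open>z\<close> is positive, so positivity for \<open>q\<close>
      and \<open>x\<close> would carry over to \<open>p\<close> and \<open>x\<close>.\<close>
    have "mball p (d p z) \<subseteq> ?V"
    proof
      fix q assume "q \<in> mball p (d p z)"
      then have q: "q \<in> M" "d p q < d p z" by auto
      have "\<not> 0 < gromov_product d z q x"
      proof
        assume pos: "0 < gromov_product d z q x"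
        have pos': "0 < gromov_product d z p q"
          using q(2) nonneg[of z q] commute[of p z] unfolding gromov_product_def by (smt (verit) half_gt_zero)
        have "min (gromov_product d z p q) (gromov_product d z q x) \<le> gromov_product d z p x"
          using F p q z xM by (simp add: four_point_iff_gromov_product[OF commute])
        then show False using pos pos' p by linarith
      qed
      then show "q \<in> ?V" using q by auto
    qed
    then show "\<exists>r>0. mball p r \<subseteq> ?V" using p z by (intro exI[of _ "d p z"]) auto
  qed auto
  have "S \<subseteq> ?U \<union> ?V" using SM zS by auto
  moreover have "x \<in> ?U" using x zS xM z by (auto simp: gromov_product_def)
  moreover have "y \<in> ?V"
    using y zS xM z commute[of x y] commute[of x z] by (auto simp: gromov_product_def)
  moreover have "?U \<inter> ?V = {}" by auto
  ultimately show False
    using S U V x y unfolding connectedin by blast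
qed

text \<open>The interval lies in \<open>S\<close> by connectedness. If the path left the interval at
  \<open>p\<close>, its pieces before and after \<open>p\<close> would both contain the point where
  the geodesics from \<open>p\<close> to \<open>x\<close> and to \<open>y\<close> part, against
  injectivity.\<close>

lemma injective_segment_eq_interval:
  assumes F: "four_point M d" and G: geodesic_space and M: "x \<in> M" "y \<in> M"
    and S: "injective_segment M d x y S"
  shows "S = {z \<in> M. d x z + d z y = d x y}"
proof
  obtain g where g: "pathin mtopology g" "inj_on g {0..1}" "g 0 = x" "g 1 = y" "S = g ` {0..1}"
    using S by (auto simp: injective_segment_def)
  have conn: "connectedin mtopology (g ` {a..b})" if "0 \<le> a" "b \<le> 1" for a b
    using g(1) that unfolding pathin_def
    by (intro connectedin_continuous_map_image[where X = "top_of_set {0..1}"])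
       (auto simp: connectedin_subtopology connectedin_iff_connected)
  have SM: "S \<subseteq> M" using path_image_subset_topspace[OF g(1)] g(5) by auto
  show "{z \<in> M. d x z + d z y = d x y} \<subseteq> S"
    using four_point_interval_subset_connectedin[OF F conn[of 0 1]] g by force
  show "S \<subseteq> {z \<in> M. d x z + d z y = d x y}"
  proof (intro subsetI CollectI conjI)
    fix p assume "p \<in> S"
    then show pM: "p \<in> M" using SM by auto
    obtain t where t: "t \<in> {0..1}" "p = g t" using \<open>p \<in> S\<close> g by auto
    define r where "r = gromov_product d p x y"
    show "d x p + d p y = d x y"
    proof (rule ccontr)
      assume ne: "d x p + d p y \<noteq> d x y"
      have r: "0 < r" "r \<le> d p x" "r \<le> d p y"
        using ne triangle[of x p y] triangle[of p x y] triangle[of p y x] M pM commute[of x p] commute[of x y]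
        unfolding r_def gromov_product_def by simp_all
      obtain gx gy where gg: "geodesic p x gx" "geodesic p y gy"
        using G M pM unfolding geodesic_space_def by meson
      define m n where "m = gx r" and "n = gy r"
      have mn: "m \<in> M" "n \<in> M" using gg r unfolding m_def n_def geodesic_def by simp_all
      have dm: "d p m = r" "d m x = d p x - r" "d p n = r" "d n y = d p y - r"
        using geodesic_dist[OF gg(1), of r] geodesic_dist[OF gg(2), of r] r unfolding m_def n_def by simp_all
      \<comment> \<open>Two applications of the four-point condition, through \<open>x\<close> and
        then through \<open>y\<close>, show \<open>m = n\<close>.\<close>
      have my: "r \<le> gromov_product d p m y"
        by (rule four_point_gromov_product[where z = x])
           (use F pM M mn dm in \<open>auto simp: gromov_product_def r_def field_simps\<close>)
      have "r \<le> gromov_product d p m n"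
        by (rule four_point_gromov_product[where z = y])
           (use my F pM M mn dm commute[of y n] in \<open>auto simp: gromov_product_def r_def field_simps\<close>)
      then have "d m n \<le> 0" using dm unfolding gromov_product_def by simp
      then have eq: "m = n" using mn by (metis nonneg zero antisym)
      \<comment> \<open>\<open>m\<close> lies between \<open>x\<close> and \<open>p\<close> and also
        between \<open>p\<close> and \<open>y\<close>, so each connected piece of the path contains
        it.\<close>
      have "m \<in> g ` {0..t}"
        by (rule four_point_interval_subset_connectedin[OF F conn[of 0 t], of x p])
           (use t g mn dm commute[of x p] commute[of x m] commute[of p m] in auto)
      moreover have "m \<in> g ` {t..1}"
        by (rule four_point_interval_subset_connectedin[OF F conn[of t 1], of p y])
           (use t g mn dm eq in auto)
      ultimately obtain a b where ab: "a \<in> {0..t}" "b \<in> {t..1}" "m = g a" "m = g b" by blast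
      then have "a = b" using inj_onD[OF g(2), of a b] t by auto
      then have "m = p" using ab t by auto
      then show False using dm r pM by simp
    qed
  qed
qed

lemma geodesic_four_point_imp_real_tree:
  assumes F: "four_point M d" and G: geodesic_space
  shows "real_tree M d"
  unfolding real_tree_def
proof (intro conjI ballI impI allI)
  fix x y assume xy: "x \<in> M" "y \<in> M" "x \<noteq> y"
  obtain g where g: "geodesic x y g" using G xy unfolding geodesic_space_def by meson
  show "\<exists>!S. injective_segment M d x y S"
    using geodesic_injective_segment[OF g xy] injective_segment_eq_interval[OF F G xy(1,2)] by metis
  fix S assume "injective_segment M d x y S"
  then have "S = g ` {0..d x y}"
    using injective_segment_eq_interval[OF F G xy(1,2)] geodesic_image[OF F xy(1,2) g] by metis
  then show "isometric_to_interval d S"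
    using g unfolding isometric_to_interval_def geodesic_def
    by (intro exI[of _ 0] exI[of _ "d x y"] exI[of _ g]) auto
qed (rule Metric_space_axioms)

end

section \<open>Embedding four-point spaces into real trees\<close>

text \<open>Distinct points may have distance 0, as happens for \<open>ln K\<close> where
  \<open>K\<close> equals 1. The triangle inequality is the four-point condition with a repeated
  point.\<close>

locale zero_hyperbolic =
  fixes M :: "'b set" and d :: "'b \<Rightarrow> 'b \<Rightarrow> real" and w :: 'b
  assumes refl: "x \<in> M \<Longrightarrow> d x x = 0"
    and sym: "d x y = d y x"
    and four: "four_point M d"
    and base: "w \<in> M"
begin

abbreviation G :: "'b \<Rightarrow> 'b \<Rightarrow> real" where "G \<equiv> gromov_product d w"

lemma triangle: "\<lbrakk>x \<in> M; y \<in> M; z \<in> M\<rbrakk> \<Longrightarrow> d x y \<le> d x z + d z y"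
  using four refl[of z] sym[of y z] unfolding four_point_def by fastforce

lemma G_sym: "G x y = G y x"
  using sym[of x y] by (simp add: gromov_product_def)

lemma G_self: "x \<in> M \<Longrightarrow> G x x = d w x"
  by (simp add: gromov_product_def refl)

lemma G_nonneg: "\<lbrakk>x \<in> M; y \<in> M\<rbrakk> \<Longrightarrow> 0 \<le> G x y"
  using triangle[of x y w] base sym[of x w] by (simp add: gromov_product_def)

lemma G_le: "\<lbrakk>x \<in> M; y \<in> M\<rbrakk> \<Longrightarrow> G x y \<le> d w x"
  using triangle[of w y x] base by (simp add: gromov_product_def)

lemma G_ultra: "\<lbrakk>x \<in> M; y \<in> M; z \<in> M\<rbrakk> \<Longrightarrow> min (G x z) (G z y) \<le> G x y"
  using four base by (simp add: four_point_iff_gromov_product[OF sym])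

section \<open>Gluing the segments from the base point\<close>

text \<open>
  The pair \<open>(x, s)\<close> stands for the point at distance \<open>s\<close> from \<open>w\<close> on the segment from \<open>w\<close> to \<open>x\<close>;
  \<open>fork p q\<close> is the height up to which the segments to \<open>p\<close> and \<open>q\<close> coincide.
\<close>

definition P :: "('b \<times> real) set" where
  "P = {(x, s). x \<in> M \<and> 0 \<le> s \<and> s \<le> d w x}"

definition fork :: "'b \<times> real \<Rightarrow> 'b \<times> real \<Rightarrow> real" where
  "fork p q = min (snd p) (min (snd q) (G (fst p) (fst q)))"

definition D :: "'b \<times> real \<Rightarrow> 'b \<times> real \<Rightarrow> real" where
  "D p q = snd p + snd q - 2 * fork p q"

lemma fork_sym: "fork p q = fork q p"
  by (simp add: fork_def G_sym[of "fst p"] min.left_commute)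

lemma fork_ultra:
  assumes "p \<in> P" "q \<in> P" "r \<in> P"
  shows "min (fork p r) (fork r q) \<le> fork p q"
proof -
  have "min (G (fst p) (fst r)) (G (fst r) (fst q)) \<le> G (fst p) (fst q)"
    using assms by (intro G_ultra) (auto simp: P_def)
  then show ?thesis by (auto simp: fork_def min_def split: if_splits)
qed

lemma D_sym: "D p q = D q p"
  by (simp add: D_def fork_sym[of p])

lemma D_nonneg: "0 \<le> D p q"
  by (auto simp: D_def fork_def min_def)

lemma D_refl: "p \<in> P \<Longrightarrow> D p p = 0"
  by (auto simp: D_def fork_def P_def G_self)

lemma D_triangle:
  assumes "p \<in> P" "q \<in> P" "r \<in> P"
  shows "D p q \<le> D p r + D r q"
proof -
  have "fork p r \<le> snd r" "fork r q \<le> snd r" by (auto simp: fork_def)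
  then show ?thesis using fork_ultra[OF assms] unfolding D_def min_def by (simp split: if_splits)
qed

text \<open>The heights \<open>snd\<close> contribute equally to the three sums, leaving a statement
  about forks that follows from \<open>fork_ultra\<close> for all triples.\<close>

lemma D_four_point:
  assumes "p \<in> P" "q \<in> P" "r \<in> P" "u \<in> P"
  shows "D p q + D r u \<le> max (D p r + D q u) (D p u + D q r)"
proof -
  have "min (fork p r + fork q u) (fork p u + fork q r) \<le> fork p q + fork r u"
    using fork_ultra[OF assms(1,2,3)] fork_ultra[OF assms(1,2,4)]
      fork_ultra[OF assms(3,4,1)] fork_ultra[OF assms(3,4,2)]
      fork_ultra[OF assms(1,3,2)] fork_ultra[OF assms(1,3,4)]
      fork_ultra[OF assms(1,4,2)] fork_ultra[OF assms(1,4,3)]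
      fork_ultra[OF assms(2,3,1)] fork_ultra[OF assms(2,3,4)]
      fork_ultra[OF assms(2,4,1)] fork_ultra[OF assms(2,4,3)]
      fork_sym[of q p] fork_sym[of r p] fork_sym[of u p] fork_sym[of r q] fork_sym[of u q]
      fork_sym[of u r]
    by (smt (verit))
  then show ?thesis unfolding D_def by (auto simp: min_def max_def split: if_splits)
qed

text \<open>A chosen representative of each class of pairs at distance 0, in place of the class
  itself, keeps the tree inside the type of pairs.\<close>

definition rep :: "'b \<times> real \<Rightarrow> 'b \<times> real" where
  "rep p = (SOME q. q \<in> P \<and> D p q = 0)"

lemma rep: "p \<in> P \<Longrightarrow> rep p \<in> P \<and> D p (rep p) = 0"
  unfolding rep_def by (rule someI[of _ p]) (simp add: D_refl)

lemma D_cong: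
  assumes "p \<in> P" "p' \<in> P" "q \<in> P" "D p p' = 0"
  shows "D p q = D p' q"
  using D_triangle[of p q p'] D_triangle[of p' q p] assms D_sym[of p' p] by simp

lemma D_rep: "\<lbrakk>p \<in> P; q \<in> P\<rbrakk> \<Longrightarrow> D (rep p) (rep q) = D p q"
  using D_cong[of p "rep p" q] D_cong[of q "rep q" "rep p"] rep[of p] rep[of q]
    D_sym[of q "rep p"] D_sym[of "rep q" "rep p"] by simp

lemma rep_eq: "\<lbrakk>p \<in> P; q \<in> P; D p q = 0\<rbrakk> \<Longrightarrow> rep p = rep q"
  unfolding rep_def using D_cong[of p q] by (metis (no_types, lifting))

sublocale tree: Metric_space "rep ` P" D
proof
  show "D p q = 0 \<longleftrightarrow> p = q" if pq: "p \<in> rep ` P" "q \<in> rep ` P" for p q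
    using that rep by (auto simp: D_rep D_refl intro: rep_eq)
  show "D p q \<le> D p r + D r q" if "p \<in> rep ` P" "r \<in> rep ` P" "q \<in> rep ` P" for p q r
    using that rep by (intro D_triangle) auto
qed (auto simp: D_nonneg intro: D_sym)

lemma tree_four_point: "four_point (rep ` P) D"
  using D_four_point rep unfolding four_point_def by blast

text \<open>The geodesic descends from one point to the fork and ascends from there to the
  other.\<close>

lemma tree_geodesic_space: "tree.geodesic_space"
  unfolding tree.geodesic_space_def
proof (intro ballI)
  fix p q assume "p \<in> rep ` P" "q \<in> rep ` P"
  then obtain x s y t where p: "p = rep (x, s)" "(x, s) \<in> P" and q: "q = rep (y, t)" "(y, t) \<in> P"
    by auto
  define m where "m = fork (x, s) (y, t)"
  have xs: "x \<in> M" "0 \<le> s" "s \<le> d w x" and yt: "y \<in> M" "0 \<le> t" "t \<le> d w y"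
    using p q by (auto simp: P_def)
  have m: "0 \<le> m" "m \<le> s" "m \<le> t" "m \<le> G x y" and m': "m = s \<or> m = t \<or> m = G x y"
    using xs yt G_nonneg[of x y] by (auto simp: m_def fork_def min_def)
  \<comment> \<open>The fork height \<open>m\<close> is reached after time \<open>s - m\<close>; the
    height after a further \<open>\<tau> - (s - m)\<close> is
    \<open>\<tau> - s + 2 * m\<close>.\<close>
  define h where "h \<tau> = (if \<tau> \<le> s - m then (x, s - \<tau>) else (y, \<tau> - s + 2 * m))" for \<tau>
  have Dpq: "D p q = s + t - 2 * m"
    using p q by (simp add: D_rep) (simp add: D_def m_def)
  have hP: "h \<tau> \<in> P" if "0 \<le> \<tau>" "\<tau> \<le> s + t - 2 * m" for \<tau>
    using that xs yt m by (auto simp: h_def P_def)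
  have iso: "D (h \<sigma>) (h \<tau>) = \<tau> - \<sigma>" if "0 \<le> \<sigma>" "\<sigma> \<le> \<tau>" "\<tau> \<le> s + t - 2 * m" for \<sigma> \<tau>
  proof -
    consider "\<tau> \<le> s - m" | "s - m < \<sigma>" | "\<sigma> \<le> s - m" "s - m < \<tau>" by linarith
    then show ?thesis
    proof cases
      case 3
      have "fork (x, s - \<sigma>) (y, \<tau> - s + 2 * m) = m"
        using 3 that m m' by (auto simp: fork_def min_def)
      then show ?thesis using 3 by (simp add: h_def D_def)
    qed (use that xs yt m G_self in \<open>auto simp: h_def D_def fork_def min_def\<close>)
  qed
  have "tree.geodesic p q (\<lambda>\<tau>. rep (h \<tau>))"
    unfolding tree.geodesic_def Dpq
  proof (intro conjI ballI)
    show "rep (h 0) = p" using p m by (simp add: h_def)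
    show "rep (h (s + t - 2 * m)) = q"
    \<comment> \<open>Here nothing is left to ascend: \<open>h\<close> ends at
      \<open>(x, m)\<close>, which is identified with \<open>(y, m)\<close> only by
      \<open>rep\<close>.\<close>
    proof (cases "t = m")
      case True
      have "rep (x, m) = rep (y, m)"
        using True xs yt m by (intro rep_eq) (auto simp: P_def D_def fork_def)
      then show ?thesis using True q by (simp add: h_def)
    qed (use q m in \<open>auto simp: h_def\<close>)
    show "rep (h \<tau>) \<in> rep ` P" if "\<tau> \<in> {0..s + t - 2 * m}" for \<tau>
      using that hP by auto
    show "D (rep (h \<sigma>)) (rep (h \<tau>)) = \<bar>\<sigma> - \<tau>\<bar>"
      if "\<sigma> \<in> {0..s + t - 2 * m}" "\<tau> \<in> {0..s + t - 2 * m}" for \<sigma> \<tau>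
      using that hP iso[of \<sigma> \<tau>] iso[of \<tau> \<sigma>] D_sym[of "h \<sigma>" "h \<tau>"]
      by (cases "\<sigma> \<le> \<tau>") (auto simp: D_rep)
  qed
  then show "\<exists>g. tree.geodesic p q g" by blast
qed

lemma real_tree: "real_tree (rep ` P) D"
  using tree_four_point tree_geodesic_space by (rule tree.geodesic_four_point_imp_real_tree)

lemma end_in_P: "x \<in> M \<Longrightarrow> (x, d w x) \<in> P"
  using G_nonneg[of x x] by (simp add: P_def G_self)

text \<open>For the far ends of two segments the fork height is the Gromov product itself, so the
  original distance is recovered.\<close>

lemma D_end: "\<lbrakk>x \<in> M; y \<in> M\<rbrakk> \<Longrightarrow> D (rep (x, d w x)) (rep (y, d w y)) = d x y"
  using G_le[of x y] G_le[of y x] G_sym[of x y]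
  by (simp add: D_rep end_in_P) (simp add: D_def fork_def min_absorb2, simp add: gromov_product_def field_simps)

end

section \<open>Kernels of hyperbolic type and the four-point condition\<close>

text \<open>The form is a sum of squares, one for the total weight of each fibre of
  \<open>\<rho>\<close>.\<close>

lemma equality_matrix_nonneg:
  fixes c :: "'i \<Rightarrow> real"
  assumes "finite I"
  shows "0 \<le> (\<Sum>i\<in>I. \<Sum>j\<in>I. c i * c j * (if \<rho> i = \<rho> j then 1 else 0))"
proof -
  let ?e = "\<lambda>v i. if \<rho> i = v then c i else 0"
  have "0 \<le> (\<Sum>v\<in>\<rho> ` I. (\<Sum>i\<in>I. ?e v i)\<^sup>2)" by (intro sum_nonneg) simp
  also have "\<dots> = (\<Sum>v\<in>\<rho> ` I. \<Sum>i\<in>I. \<Sum>j\<in>I. ?e v i * ?e v j)"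
    by (simp add: power2_eq_square sum_product)
  also have "\<dots> = (\<Sum>i\<in>I. \<Sum>v\<in>\<rho> ` I. \<Sum>j\<in>I. ?e v i * ?e v j)" by (rule sum.swap)
  also have "\<dots> = (\<Sum>i\<in>I. \<Sum>j\<in>I. \<Sum>v\<in>\<rho> ` I. ?e v i * ?e v j)"
    by (intro sum.cong refl sum.swap)
  also have "\<dots> = (\<Sum>i\<in>I. \<Sum>j\<in>I. c i * c j * (if \<rho> i = \<rho> j then 1 else 0))"
  proof (intro sum.cong refl)
    fix i j assume "i \<in> I" "j \<in> I"
    have "(\<Sum>v\<in>\<rho> ` I. ?e v i * ?e v j) = (\<Sum>v\<in>\<rho> ` I. if \<rho> i = v then c i * ?e (\<rho> i) j else 0)"
      by (intro sum.cong) auto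
    also have "\<dots> = c i * c j * (if \<rho> i = \<rho> j then 1 else 0)"
      using \<open>i \<in> I\<close> assms by (simp add: sum.delta)
    finally show "(\<Sum>v\<in>\<rho> ` I. ?e v i * ?e v j) = c i * c j * (if \<rho> i = \<rho> j then 1 else 0)" .
  qed
  finally show ?thesis .
qed

text \<open>
  Each level set \<open>{(i, j). u \<le> A i j}\<close> is an equivalence relation on a subset of \<open>I\<close>, and \<open>A\<close> is the
  integral over \<open>u\<close> of the indicator functions of its level sets.
\<close>

lemma ultrametric_matrix_nonneg:
  fixes A :: "'i \<Rightarrow> 'i \<Rightarrow> real" and c :: "'i \<Rightarrow> real"
  assumes fin: "finite I" and nonneg: "\<And>i j. \<lbrakk>i \<in> I; j \<in> I\<rbrakk> \<Longrightarrow> 0 \<le> A i j"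
    and sym: "\<And>i j. \<lbrakk>i \<in> I; j \<in> I\<rbrakk> \<Longrightarrow> A i j = A j i"
    and ultra: "\<And>i j k. \<lbrakk>i \<in> I; j \<in> I; k \<in> I\<rbrakk> \<Longrightarrow> min (A i k) (A k j) \<le> A i j"
  shows "0 \<le> (\<Sum>i\<in>I. \<Sum>j\<in>I. c i * c j * A i j)"
proof -
  have "finite ((\<lambda>(i, j). A i j) ` (I \<times> I))" using fin by simp
  then obtain B where B: "\<And>i j. \<lbrakk>i \<in> I; j \<in> I\<rbrakk> \<Longrightarrow> A i j \<le> B"
    using bdd_above_finite[of "(\<lambda>(i, j). A i j) ` (I \<times> I)"] unfolding bdd_above_def by force
  let ?\<chi> = "\<lambda>i j u. if u \<in> {0..A i j} then 1 else 0 :: real"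
  have "((\<lambda>u. \<Sum>i\<in>I. \<Sum>j\<in>I. c i * c j * ?\<chi> i j u) has_integral (\<Sum>i\<in>I. \<Sum>j\<in>I. c i * c j * A i j)) {0..B}"
  proof (intro has_integral_sum fin has_integral_mult_right)
    fix i j assume ij: "i \<in> I" "j \<in> I"
    have "((\<lambda>u. 1 :: real) has_integral A i j) {0..A i j}"
      using has_integral_const_real[of "1::real" 0 "A i j"] nonneg[OF ij] by simp
    then show "(?\<chi> i j has_integral A i j) {0..B}"
      using B[OF ij] by (subst has_integral_restrict) auto
  qed
  then show ?thesis
  proof (rule has_integral_nonneg)
    fix u assume "u \<in> {0..B}"
    define \<rho> where "\<rho> i = {k \<in> I. u \<le> A i k}" for i
    \<comment> \<open>Indices with \<open>A i i < u\<close> lie outside the equivalence relation at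
      level \<open>u\<close> and get weight 0.\<close>
    define c' where "c' i = (if u \<le> A i i then c i else 0)" for i
    have trans: "u \<le> A i j" if "i \<in> I" "j \<in> I" "k \<in> I" "u \<le> A i k" "u \<le> A k j" for i j k
      using ultra[of i j k] that by linarith
    have "c i * c j * ?\<chi> i j u = c' i * c' j * (if \<rho> i = \<rho> j then 1 else 0)"
      if ij: "i \<in> I" "j \<in> I" for i j
    proof (cases "u \<le> A i j")
      case True
      then have u: "u \<le> A j i" using sym[OF ij] by simp
      have "u \<le> A i i" "u \<le> A j j" using trans[of i i j] trans[of j j i] ij True u by auto
      moreover have "\<rho> i = \<rho> j" using trans ij True u unfolding \<rho>_def by blast
      ultimately show ?thesis using True \<open>u \<in> {0..B}\<close> by (simp add: c'_def)
    next
      case False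
      then have "\<rho> i \<noteq> \<rho> j \<or> \<not> u \<le> A j j" using ij by (auto simp: \<rho>_def)
      then show ?thesis using False by (auto simp: c'_def)
    qed
    then have "(\<Sum>i\<in>I. \<Sum>j\<in>I. c i * c j * ?\<chi> i j u) =
        (\<Sum>i\<in>I. \<Sum>j\<in>I. c' i * c' j * (if \<rho> i = \<rho> j then 1 else 0))"
      by (intro sum.cong refl)
    then show "0 \<le> (\<Sum>i\<in>I. \<Sum>j\<in>I. c i * c j * ?\<chi> i j u)"
      using equality_matrix_nonneg[OF fin, of c' \<rho>] by (simp only:)
  qed
qed

text \<open>After rescaling the coefficients to \<open>a\<close>, the right side minus the left side
  is the quadratic form of \<open>A\<close>. Being a nondecreasing function of the Gromov product,
  \<open>A\<close> inherits its ultrametric inequality.\<close>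

lemma (in Metric_space) four_point_exp_inequality:
  fixes x :: "nat \<Rightarrow> 'a" and c :: "nat \<Rightarrow> real"
  assumes F: "four_point M d" and x: "\<And>i. i \<in> {0..n} \<Longrightarrow> x i \<in> M" and t: "0 \<le> t"
  shows "(\<Sum>i=1..n. \<Sum>j=1..n. c i * c j * exp (t * d (x i) (x j))) \<le>
         (\<Sum>k=1..n. c k * exp (t * d (x 0) (x k)))\<^sup>2"
proof -
  define a where "a k = c k * exp (t * d (x 0) (x k))" for k
  define A where "A i j = 1 - exp (- (2 * t * gromov_product d (x 0) (x i) (x j)))" for i j
  have aA: "a i * a j * A i j = a i * a j - c i * c j * exp (t * d (x i) (x j))" for i j
  proof -
    have "t * d (x i) (x j) = t * d (x 0) (x i) + (t * d (x 0) (x j) +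
        - (2 * t * gromov_product d (x 0) (x i) (x j)))"
      by (simp add: gromov_product_def field_simps)
    then have "exp (t * d (x i) (x j)) = exp (t * d (x 0) (x i)) * (exp (t * d (x 0) (x j)) *
        exp (- (2 * t * gromov_product d (x 0) (x i) (x j))))"
      by (simp only: exp_add)
    then show ?thesis by (simp add: a_def A_def algebra_simps)
  qed
  have xM: "x 0 \<in> M" "\<And>i. i \<in> {1..n} \<Longrightarrow> x i \<in> M" using x by auto
  have "0 \<le> (\<Sum>i=1..n. \<Sum>j=1..n. a i * a j * A i j)"
  proof (rule ultrametric_matrix_nonneg)
    fix i j assume ij: "i \<in> {1..n}" "j \<in> {1..n}"
    show "A i j = A j i" using commute[of "x i" "x j"] by (simp add: A_def gromov_product_def add.commute)
    have "0 \<le> gromov_product d (x 0) (x i) (x j)"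
      using triangle[of "x i" "x 0" "x j"] xM ij commute[of "x i" "x 0"] by (simp add: gromov_product_def)
    then show "0 \<le> A i j" using t by (simp add: A_def)
    fix k assume k: "k \<in> {1..n}"
    have "min (gromov_product d (x 0) (x i) (x k)) (gromov_product d (x 0) (x k) (x j))
        \<le> gromov_product d (x 0) (x i) (x j)"
      using F xM ij k by (simp add: four_point_iff_gromov_product[OF commute])
    then consider "gromov_product d (x 0) (x i) (x k) \<le> gromov_product d (x 0) (x i) (x j)"
      | "gromov_product d (x 0) (x k) (x j) \<le> gromov_product d (x 0) (x i) (x j)" by linarith
    then have "A i k \<le> A i j \<or> A k j \<le> A i j"
      using t by cases (auto simp: A_def mult_left_mono)
    then show "min (A i k) (A k j) \<le> A i j" by linarith
  qed simp
  also have "\<dots> = (\<Sum>k=1..n. a k)\<^sup>2 - (\<Sum>i=1..n. \<Sum>j=1..n. c i * c j * exp (t * d (x i) (x j)))"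
    by (simp add: aA sum_subtractf power2_eq_square sum_product)
  finally show ?thesis by (simp add: a_def)
qed

text \<open>The hyperbolic inequality for the single point \<open>y\<close> based at
  \<open>x\<close> bounds the diagonal value 1 by the square of \<open>K x y\<close>.\<close>

lemma hyperbolic_kernel_ge_1:
  assumes K: "hyperbolic_kernel X K" and x: "x \<in> topspace X" "y \<in> topspace X"
  shows "1 \<le> K x y"
proof -
  have "(\<Sum>i=1..1. \<Sum>j=1..1. 1 * 1 * K ((\<lambda>i::nat. if i = 0 then x else y) i) ((\<lambda>i::nat. if i = 0 then x else y) j))
      \<le> (\<Sum>k=1..1. 1 * K ((\<lambda>i::nat. if i = 0 then x else y) 0) ((\<lambda>i::nat. if i = 0 then x else y) k))\<^sup>2"
    using K x unfolding hyperbolic_kernel_def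
    by (elim conjE allE[of _ "1::nat"] allE[of _ "\<lambda>i::nat. if i = 0 then x else y"] allE[of _ "\<lambda>_::nat. 1::real"]) auto
  then have "1 \<le> (K x y)\<^sup>2" using K x by (simp add: hyperbolic_kernel_def)
  moreover have "0 \<le> K x y" using K x by (simp add: hyperbolic_kernel_def)
  ultimately show ?thesis using power2_le_imp_le[of 1 "K x y"] by simp
qed

text \<open>The coefficients are chosen such that the right-hand side of the hyperbolic inequality
  based at \<open>w\<close> vanishes.\<close>

lemma hyperbolic_kernel_four_points:
  assumes K: "hyperbolic_kernel X K"
    and x: "x \<in> topspace X" "y \<in> topspace X" "z \<in> topspace X" "w \<in> topspace X"
  shows "K x y * K z w \<le> 2 * (K x z * K y w + K x w * K y z)"
proof -
  define a b e where "a = K w x" and "b = K w y" and "e = K w z"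
  define \<alpha> \<beta> \<gamma> where "\<alpha> = inverse a" and "\<beta> = inverse b" and "\<gamma> = inverse e"
  have pos: "0 < a" "0 < b" "0 < e"
    using hyperbolic_kernel_ge_1[OF K] x unfolding a_def b_def e_def by (meson less_le_trans zero_less_one)+
  then have inv: "\<alpha> * a = 1" "\<beta> * b = 1" "\<gamma> * e = 1" by (simp_all add: \<alpha>_def \<beta>_def \<gamma>_def)
  have sym: "K y x = K x y" "K z x = K x z" "K z y = K y z" "K z w = e" "K y w = b" "K x w = a"
    and diag: "K x x = 1" "K y y = 1" "K z z = 1"
    using K x by (auto simp: hyperbolic_kernel_def kernel_def a_def b_def e_def)
  define p where "p i = (if i = 0 then w else if i = 1 then x else if i = 2 then y else z)" for i :: nat
  \<comment> \<open>Against the values \<open>a\<close>, \<open>b\<close>, \<open>e\<close> these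
    weights give 1 + 1 - 2 = 0.\<close>
  define c where "c i = (if i = 1 then \<alpha> else if i = 2 then \<beta> else - 2 * \<gamma>)" for i :: nat
  have "\<forall>i\<in>{0..3}. p i \<in> topspace X" using x by (simp add: p_def)
  then have "(\<Sum>i=1..3. \<Sum>j=1..3. c i * c j * K (p i) (p j)) \<le> (\<Sum>k=1..3. c k * K (p 0) (p k))\<^sup>2"
    using K unfolding hyperbolic_kernel_def by blast
  moreover have "(\<Sum>k=1..3. c k * K (p 0) (p k)) = 0"
    using inv by (simp add: p_def c_def numeral_3_eq_3 flip: a_def b_def e_def)
  moreover have "(\<Sum>i=1..3. \<Sum>j=1..3. c i * c j * K (p i) (p j)) =
      \<alpha>\<^sup>2 + \<beta>\<^sup>2 + 4 * \<gamma>\<^sup>2 + 2 * (\<alpha> * \<beta> * K x y) - 4 * (\<alpha> * \<gamma> * K x z) - 4 * (\<beta> * \<gamma> * K y z)"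
    by (simp add: p_def c_def numeral_3_eq_3 sym diag) (simp add: power2_eq_square algebra_simps)
  ultimately have "\<alpha>\<^sup>2 + \<beta>\<^sup>2 + 4 * \<gamma>\<^sup>2 + 2 * (\<alpha> * \<beta> * K x y) - 4 * (\<alpha> * \<gamma> * K x z) - 4 * (\<beta> * \<gamma> * K y z) \<le> 0"
    by simp
  \<comment> \<open>The three squares are nonnegative and are dropped; multiplication by
    \<open>a * b * e\<close> then clears the denominators.\<close>
  then have "\<alpha> * \<beta> * K x y \<le> 2 * (\<alpha> * \<gamma> * K x z + \<beta> * \<gamma> * K y z)"
    by (smt (verit) zero_le_power2)
  then have "\<alpha> * \<beta> * K x y * (a * b * e) \<le> 2 * (\<alpha> * \<gamma> * K x z + \<beta> * \<gamma> * K y z) * (a * b * e)"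
    using pos by (intro mult_right_mono) auto
  then have "(\<alpha> * a) * (\<beta> * b) * (K x y * e) \<le>
      2 * ((\<alpha> * a) * (\<gamma> * e) * (K x z * b) + (\<beta> * b) * (\<gamma> * e) * (K y z * a))"
    by (simp add: algebra_simps)
  then show ?thesis by (simp add: inv sym mult.commute)
qed

section \<open>Letting the exponent tend to infinity\<close>

lemma critical_exponent_eq_infinity_iff:
  "critical_exponent X K = \<infinity> \<longleftrightarrow>
     (\<forall>B. \<exists>t\<ge>B. 1 \<le> t \<and> hyperbolic_kernel X (\<lambda>x y. K x y powr t))"
proof
  assume inf: "critical_exponent X K = \<infinity>"
  show "\<forall>B. \<exists>t\<ge>B. 1 \<le> t \<and> hyperbolic_kernel X (\<lambda>x y. K x y powr t)"
  proof
    fix B :: real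
    have "ereal B < critical_exponent X K" using inf by simp
    then obtain t where "1 \<le> t" "hyperbolic_kernel X (\<lambda>x y. K x y powr t)" "ereal B < ereal t"
      unfolding critical_exponent_def less_SUP_iff by auto
    then show "\<exists>t\<ge>B. 1 \<le> t \<and> hyperbolic_kernel X (\<lambda>x y. K x y powr t)"
      by (intro exI[of _ t]) auto
  qed
next
  assume *: "\<forall>B. \<exists>t\<ge>B. 1 \<le> t \<and> hyperbolic_kernel X (\<lambda>x y. K x y powr t)"
  show "critical_exponent X K = \<infinity>"
    unfolding critical_exponent_def
  proof (rule SUP_PInfty)
    fix n :: nat
    show "\<exists>t\<in>{t. 1 \<le> t \<and> hyperbolic_kernel X (\<lambda>x y. K x y powr t)}. ereal (real n) \<le> ereal t"
      using *[rule_format, of "real n"] by auto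
  qed
qed

text \<open>Otherwise the powers of \<open>p / max q r\<close>, a number above 1, would stay below
  \<open>2 * C\<close> for arbitrarily large exponents.\<close>

lemma le_max_of_powr_le:
  fixes p q r :: real
  assumes pos: "0 < p" "0 < q" "0 < r" "0 < C"
    and le: "\<And>B. \<exists>t\<ge>B. 1 \<le> t \<and> p powr t \<le> C * (q powr t + r powr t)"
  shows "p \<le> max q r"
proof (rule ccontr)
  let ?m = "max q r"
  assume "\<not> p \<le> ?m"
  then have m: "0 < ?m" "1 < p / ?m" using pos by (auto simp: field_simps)
  have ln_pos: "0 < ln (p / ?m)" using m(2) by (rule ln_gt_zero)
  obtain t where t: "ln (2 * C) / ln (p / ?m) + 1 \<le> t" "1 \<le> t" "p powr t \<le> C * (q powr t + r powr t)"
    using le by blast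
  have "q powr t \<le> ?m powr t" "r powr t \<le> ?m powr t" using pos t(2) by (auto intro!: powr_mono2)
  then have "C * (q powr t + r powr t) \<le> C * (?m powr t + ?m powr t)"
    using pos by (intro mult_left_mono add_mono) auto
  then have "p powr t \<le> (2 * C) * ?m powr t" using t(3) by simp
  then have "(p / ?m) powr t \<le> 2 * C" using pos m by (simp add: powr_divide field_simps)
  then have "ln ((p / ?m) powr t) \<le> ln (2 * C)" using pos m by (subst ln_le_cancel_iff) auto
  then have "t * ln (p / ?m) \<le> ln (2 * C)" using m pos by (simp add: ln_powr)
  then have "t \<le> ln (2 * C) / ln (p / ?m)" using ln_pos by (simp add: field_simps)
  then show False using t(1) by simp
qed

lemma infinite_critical_exponent_four_points:
  assumes K: "hyperbolic_kernel X K" and inf: "critical_exponent X K = \<infinity>"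
    and x: "x \<in> topspace X" "y \<in> topspace X" "z \<in> topspace X" "w \<in> topspace X"
  shows "K x y * K z w \<le> max (K x z * K y w) (K x w * K y z)"
proof (rule le_max_of_powr_le)
  have ge: "1 \<le> K u v" if "u \<in> topspace X" "v \<in> topspace X" for u v
    using hyperbolic_kernel_ge_1[OF K that] .
  have pos: "0 < K u v" if "u \<in> topspace X" "v \<in> topspace X" for u v
    using ge[OF that] by simp
  show "0 < K x y * K z w" "0 < K x z * K y w" "0 < K x w * K y z" using x pos by simp_all
  fix B
  obtain t where t: "B \<le> t" "1 \<le> t" "hyperbolic_kernel X (\<lambda>x y. K x y powr t)"
    using inf unfolding critical_exponent_eq_infinity_iff by blast
  have "(K x y * K z w) powr t \<le> 2 * ((K x z * K y w) powr t + (K x w * K y z) powr t)"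
    using hyperbolic_kernel_four_points[OF t(3) x] x pos by (simp add: powr_mult less_imp_le)
  then show "\<exists>t\<ge>B. 1 \<le> t \<and> (K x y * K z w) powr t \<le> 2 * ((K x z * K y w) powr t + (K x w * K y z) powr t)"
    using t by blast
qed simp

section \<open>From kernels to trees and back\<close>

lemma infinite_critical_exponent_imp_arboreal:
  assumes K: "hyperbolic_kernel X K" and inf: "critical_exponent X K = \<infinity>"
  shows "arboreal X K"
proof (cases "topspace X = {}")
  \<comment> \<open>An empty space offers no base point; the empty tree serves.\<close>
  case True
  have "real_tree {} (\<lambda>_ _. 0)" by (auto simp: real_tree_def Metric_space_def)
  then show ?thesis using True by (intro arborealI) auto
next
  case False
  then obtain w where w: "w \<in> topspace X" by blast
  \<comment> \<open>The value 0 off the space makes \<open>d\<close> symmetric everywhere, as the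
    locale requires.\<close>
  define d where "d x y = (if x \<in> topspace X \<and> y \<in> topspace X then ln (K x y) else 0)" for x y
  have pos: "0 < K x y" if "x \<in> topspace X" "y \<in> topspace X" for x y
    using hyperbolic_kernel_ge_1[OF K that] by simp
  interpret zero_hyperbolic "topspace X" d w
  proof
    show "d x x = 0" if "x \<in> topspace X" for x
      using K that by (simp add: d_def hyperbolic_kernel_def)
    show "d x y = d y x" for x y
      using K by (simp add: d_def hyperbolic_kernel_def kernel_def)
    show "four_point (topspace X) d"
      unfolding four_point_def
    proof (intro ballI)
      fix x y z u assume x: "x \<in> topspace X" "y \<in> topspace X" "z \<in> topspace X" "u \<in> topspace X"
      then consider "K x y * K z u \<le> K x z * K y u" | "K x y * K z u \<le> K x u * K y z"
        using infinite_critical_exponent_four_points[OF K inf x] by linarith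
      then have "ln (K x y * K z u) \<le> ln (K x z * K y u) \<or> ln (K x y * K z u) \<le> ln (K x u * K y z)"
        by cases (use x pos in \<open>auto intro: ln_mono\<close>)
      moreover have "ln (K a b * K c e) = ln (K a b) + ln (K c e)"
        if "a \<in> topspace X" "b \<in> topspace X" "c \<in> topspace X" "e \<in> topspace X" for a b c e
        using pos[of a b] pos[of c e] that by (simp add: ln_mult)
      ultimately show "d x y + d z u \<le> max (d x z + d y u) (d x u + d y z)"
        using x by (simp add: d_def le_max_iff_disj)
    qed
  qed (rule w)
  show ?thesis
  proof (rule arborealI[OF real_tree])
    show "(\<lambda>x. rep (x, d w x)) \<in> topspace X \<rightarrow> rep ` P" using end_in_P by blast
    show "K x y = exp (D (rep (x, d w x)) (rep (y, d w y)))"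
      if "x \<in> topspace X" "y \<in> topspace X" for x y
      using that pos by (simp add: D_end) (simp add: d_def)
  qed
qed

lemma arboreal_imp_hyperbolic_kernel_powr:
  assumes K: "hyperbolic_kernel X K" and tree: "arboreal X K" and t: "0 \<le> t"
  shows "hyperbolic_kernel X (\<lambda>x y. K x y powr t)"
proof -
  obtain T :: "('a \<times> real) set" and d f where T: "real_tree T d" and f: "f \<in> topspace X \<rightarrow> T"
    and Kd: "\<And>x y. \<lbrakk>x \<in> topspace X; y \<in> topspace X\<rbrakk> \<Longrightarrow> K x y = exp (d (f x) (f y))"
    using tree unfolding arboreal_def by blast
  interpret Metric_space T d using T by (simp add: real_tree_def)
  have ge: "1 \<le> K x y" if "x \<in> topspace X" "y \<in> topspace X" for x y
    using hyperbolic_kernel_ge_1[OF K that] .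
  have Kt: "K x y powr t = exp (t * d (f x) (f y))" if "x \<in> topspace X" "y \<in> topspace X" for x y
    using that by (simp add: Kd exp_powr_real mult.commute)
  \<comment> \<open>Restricting the range to numbers from 1 on keeps the base away from 0, where
    continuity of \<open>powr\<close> is delicate.\<close>
  have "continuous_map (prod_topology X X) (top_of_set {1..}) (\<lambda>(x, y). K x y)"
    using K ge by (auto simp: hyperbolic_kernel_def kernel_def continuous_map_in_subtopology)
  moreover have "continuous_map (top_of_set {1..}) euclideanreal (\<lambda>r. r powr t)"
    by (auto intro!: continuous_intros)
  ultimately have "continuous_map (prod_topology X X) euclideanreal ((\<lambda>r. r powr t) \<circ> (\<lambda>(x, y). K x y))"
    by (rule continuous_map_compose)
  then have "kernel X (\<lambda>x y. K x y powr t)"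
    using K by (simp add: hyperbolic_kernel_def kernel_def case_prod_unfold comp_def)
  moreover have "(\<Sum>i=1..n. \<Sum>j=1..n. c i * c j * K (x i) (x j) powr t) \<le> (\<Sum>k=1..n. c k * K (x 0) (x k) powr t)\<^sup>2"
    if x: "\<forall>i\<in>{0..n}. x i \<in> topspace X" for n :: nat and x and c :: "nat \<Rightarrow> real"
  proof -
    have "(\<Sum>i=1..n. \<Sum>j=1..n. c i * c j * exp (t * d (f (x i)) (f (x j)))) \<le>
        (\<Sum>k=1..n. c k * exp (t * d (f (x 0)) (f (x k))))\<^sup>2"
      using x f t real_tree_imp_four_point[OF T]
      by (intro four_point_exp_inequality[where x = "\<lambda>i. f (x i)"]) auto
    then show ?thesis using x by (simp add: Kt)
  qed
  ultimately show ?thesis using K by (simp add: hyperbolic_kernel_def)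
qed

theorem proposition5p3:
  fixes X :: "'a topology" and K :: "'a \<Rightarrow> 'a \<Rightarrow> real"
  assumes "hyperbolic_kernel X K"
  shows "arboreal X K \<longleftrightarrow> critical_exponent X K = \<infinity>"
proof
  assume "arboreal X K"
  \<comment> \<open>The maximum turns an arbitrary bound \<open>B\<close> into an admissible
    exponent that is at least 1.\<close>
  then have "hyperbolic_kernel X (\<lambda>x y. K x y powr max B 1)" for B
    by (intro arboreal_imp_hyperbolic_kernel_powr[OF assms]) auto
  then show "critical_exponent X K = \<infinity>"
    unfolding critical_exponent_eq_infinity_iff by (metis max.cobounded1 max.cobounded2)
qed (rule infinite_critical_exponent_imp_arboreal[OF assms])

end
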